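(* Let $V\hookrightarrow H$ be a continuous and dense embedding of Hilbert spaces, with $H$ ordered by a closed convex cone $H_+$ as described in the context, and let $\Phi\colon H\to V$ be increasing. Suppose that there exists $v_0\in V$ such that $v_0\le\Phi(v_0)$. Let $f\in V^*$ satisfy $Av_0\le f\le F$ in $V^*$ for some $F\in V^*$. Then there exist solutions $y\in V$ of $$y\le\Phi(y),\qquad \langle Ay-f,\,y-v\rangle\le 0\quad\forall v\in V:\ v\le\Phi(y),$$ lying in the order interval $[v_0,A^{-1}F]$, i.e. with $v_0\le y\le A^{-1}F$. Furthermore, among the solutions in this interval there exist a minimal (smallest) and a maximal (largest) one.
   Context: All spaces are real. $C\subset H$ is a closed convex cone with $C=\{h\in H:(h,g)_H\ge0\ \forall g\in C\}$. The order on $H$ is $h_1\le h_2$ iff $h_2-h_1\in C$, so $H_+=C$; with this order $H$ is a vector lattice. $h^+$ denotes the orthogonal projection of $h$ onto $H_+$ and $h^-:=h^+-h$. It is assumed that $v\in V$ implies $v^+\in V$ and that there is a constant $c>0$ with $\|v^+\|_V\le c\|v\|_V$ for all $v\in V$. $V$ carries the order induced from $H$, $V_+:=\{v\in V:v\ge0\}$, and for $g_1,g_2\in V^*$, $g_1\le g_2$ means $\langle g_2-g_1,v\rangle\ge0$ for all $v\in V_+$. $\Phi$ increasing means $h_1\le h_2\Rightarrow\Phi(h_1)\le\Phi(h_2)$. $A\colon V\to V^*$ is linear and there are constants $C_a,C_b>0$ with $\langle Au,v\rangle\le C_b\|u\|_V\|v\|_V$, $\langle Au,u\rangle\ge C_a\|u\|_V^2$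 and $\langle Au^+,u^-\rangle\le0$ for all $u,v\in V$. *)

theory Defs
  imports "HOL-Analysis.Analysis"
begin

definition cone_le :: "'h::real_inner set \<Rightarrow> 'h \<Rightarrow> 'h \<Rightarrow> bool"
  where "cone_le C h1 h2 \<longleftrightarrow> h2 - h1 \<in> C"

definition self_dual :: "'h::real_inner set \<Rightarrow> bool"
  where "self_dual C \<longleftrightarrow> C = {h. \<forall>g\<in>C. h \<bullet> g \<ge> 0}"

text \<open>
  Compatibility of the order with addition and nonnegative scaling is automatic, since the order
  is induced by a convex cone; so the lattice property is all that a vector lattice adds.
\<close>

definition vector_lattice :: "'h::real_inner set \<Rightarrow> bool"
  where "vector_lattice C \<longleftrightarrow> (\<exists>inf sup.
    class.lattice inf (cone_le C) (\<lambda>x y. cone_le C x y \<and> \<not> cone_le C y x) sup)"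

text \<open>
  Orthogonal projection onto a set. This is the formula of \<open>closest_point\<close>, which the library
  restricts to Heine--Borel (hence finite-dimensional) spaces. For a nonempty closed convex set in
  a Hilbert space the minimizer exists and is unique.
\<close>

definition projection :: "'h::real_inner set \<Rightarrow> 'h \<Rightarrow> 'h"
  where "projection S h = (SOME p. p \<in> S \<and> (\<forall>q\<in>S. dist h p \<le> dist h q))"

text \<open>
  The space \<open>V\<close> is a type of its own with its own inner product, and \<open>\<iota>\<close> is the embedding
  of \<open>V\<close> into \<open>H\<close>.
\<close>

definition dense_embedding :: "('v::real_inner \<Rightarrow> 'h::real_inner) \<Rightarrow> bool"
  where "dense_embedding \<iota> \<longleftrightarrow>
    bounded_linear \<iota> \<and> inj \<iota> \<and> closure (range \<iota>) = UNIV"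

definition V_le :: "'h::real_inner set \<Rightarrow> ('v::real_inner \<Rightarrow> 'h) \<Rightarrow> 'v \<Rightarrow> 'v \<Rightarrow> bool"
  where "V_le C \<iota> u v \<longleftrightarrow> cone_le C (\<iota> u) (\<iota> v)"

text \<open>
  \<open>v\<^sup>+\<close> and \<open>v\<^sup>-\<close> as elements of \<open>V\<close>. The former is meaningful only when the projection of
  \<open>\<iota> v\<close> onto the cone lies in the range of the (injective) embedding.
\<close>

definition pos_part :: "'h::real_inner set \<Rightarrow> ('v::real_inner \<Rightarrow> 'h) \<Rightarrow> 'v \<Rightarrow> 'v"
  where "pos_part C \<iota> v = inv \<iota> (projection C (\<iota> v))"

definition neg_part :: "'h::real_inner set \<Rightarrow> ('v::real_inner \<Rightarrow> 'h) \<Rightarrow> 'v \<Rightarrow> 'v"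
  where "neg_part C \<iota> v = pos_part C \<iota> v - v"

definition dual_le ::
  "'h::real_inner set \<Rightarrow> ('v::real_inner \<Rightarrow> 'h) \<Rightarrow> ('v \<Rightarrow>\<^sub>L real) \<Rightarrow> ('v \<Rightarrow>\<^sub>L real) \<Rightarrow> bool"
  where "dual_le C \<iota> g1 g2 \<longleftrightarrow>
    (\<forall>v. V_le C \<iota> 0 v \<longrightarrow> blinfun_apply (g2 - g1) v \<ge> 0)"

definition qvi_solution ::
  "'h::real_inner set \<Rightarrow> ('v::real_inner \<Rightarrow> 'h) \<Rightarrow> ('v \<Rightarrow> 'v \<Rightarrow>\<^sub>L real) \<Rightarrow> ('h \<Rightarrow> 'v)
    \<Rightarrow> ('v \<Rightarrow>\<^sub>L real) \<Rightarrow> 'v \<Rightarrow> bool"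
  where "qvi_solution C \<iota> A \<Phi> f y \<longleftrightarrow>
    V_le C \<iota> y (\<Phi> (\<iota> y)) \<and>
    (\<forall>v. V_le C \<iota> v (\<Phi> (\<iota> y)) \<longrightarrow> blinfun_apply (A y - f) (y - v) \<le> 0)"

end

theory Submission
  imports Defs
begin

text \<open>
  For a self-dual cone that induces a lattice order, the projection onto the cone is the lattice
  positive part, and order intervals of \<open>H\<close> are complete lattices: the least upper bound of a set
  is the point closest to a given lower bound among all upper bounds. The map \<open>T\<close> sending \<open>w\<close> to the
  solution of the variational inequality with the fixed obstacle \<open>\<Phi> w\<close> exists by
  Lions--Stampacchia and is increasing by the T-monotonicity of \<open>A\<close>; moreover \<open>v\<^sub>0 \<le> T v\<^sub>0\<close>, and
  \<open>A\<inverse>F\<close> is an upper bound of the range of \<open>T\<close>. The solutions in the interval are the fixed points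
  of \<open>T\<close> there, so the claim is the Knaster--Tarski theorem.
\<close>

section \<open>Projections and variational inequalities in Hilbert spaces\<close>

text \<open>By the parallelogram law a minimizing sequence for the distance is Cauchy, since
  midpoints stay in the convex set; completeness and closedness give the minimizer.\<close>

lemma closest_point_exists_Hilbert:
  fixes S :: "'a::{real_inner, complete_space} set"
  assumes "convex S" "closed S" "S \<noteq> {}"
  shows "\<exists>p\<in>S. \<forall>q\<in>S. dist h p \<le> dist h q"
proof -
  define d where "d = (INF q\<in>S. dist h q)"
  have bdd: "bdd_below ((\<lambda>q. dist h q) ` S)"
    by (rule bdd_belowI2[of _ 0]) simp
  have d_le: "d \<le> dist h q" if "q \<in> S" for q
    unfolding d_def using bdd that by (rule cINF_lower)
  have "d \<ge> 0"
    unfolding d_def using assms(3) by (intro cINF_greatest) auto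
  have near: "\<exists>q\<in>S. dist h q < d + e" if "e > 0" for e
  proof (rule ccontr)
    assume "\<not> ?thesis"
    then have "d + e \<le> d"
      unfolding d_def[symmetric] using assms(3)
      by (subst (2) d_def) (intro cINF_greatest; force simp: not_less)
    with that show False by simp
  qed
  then have "\<forall>n. \<exists>q\<in>S. dist h q < d + inverse (real (Suc n))" by simp
  then obtain x where x: "\<And>n. x n \<in> S" "\<And>n. dist h (x n) < d + inverse (real (Suc n))"
    by metis
  have close: "(dist (x m) (x n))\<^sup>2 < e\<^sup>2"
    if "e > 0" "\<delta> > 0" "\<delta> \<le> 1" "\<delta> * (8 * d + 4) < e\<^sup>2" "dist h (x m) < d + \<delta>" "dist h (x n) < d + \<delta>"
    for e \<delta> m n
  proof -
    have mid: "(1/2) *\<^sub>R x m + (1/2) *\<^sub>R x n \<in> S"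
      using convexD[OF assms(1) x(1)[of m] x(1)[of n], of "1/2" "1/2"] by simp
    \<comment> \<open>Parallelogram law. Since the midpoint is at distance at least
      \<open>d\<close>, the right-hand side is at most 4 (d + \<delta>)^2 - 4 d^2, which is at most
      \<open>\<delta> * (8 * d + 4)\<close> for \<delta> \<le> 1.\<close>
    have "(dist (x m) (x n))\<^sup>2 = 2 * (dist h (x m))\<^sup>2 + 2 * (dist h (x n))\<^sup>2
        - 4 * (dist h ((1/2) *\<^sub>R x m + (1/2) *\<^sub>R x n))\<^sup>2"
      by (simp add: dist_norm power2_norm_eq_inner algebra_simps inner_commute)
    moreover have "d\<^sup>2 \<le> (dist h ((1/2) *\<^sub>R x m + (1/2) *\<^sub>R x n))\<^sup>2"
      using d_le[OF mid] \<open>d \<ge> 0\<close> by (intro power_mono)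
    moreover have "(dist h (x m))\<^sup>2 \<le> (d + \<delta>)\<^sup>2" "(dist h (x n))\<^sup>2 \<le> (d + \<delta>)\<^sup>2"
      using that by (auto intro!: power_mono)
    moreover have "(d + \<delta>)\<^sup>2 \<le> d\<^sup>2 + \<delta> * (2 * d + 1)"
      using mult_left_mono[of \<delta> 1 \<delta>] that by (simp add: power2_eq_square algebra_simps)
    moreover have "\<delta> * (8 * d + 4) = 4 * (\<delta> * (2 * d + 1))" by simp
    ultimately show ?thesis using that(4) by linarith
  qed
  have "Cauchy x"
  proof (rule metric_CauchyI)
    fix e :: real assume "e > 0"
    \<comment> \<open>The bound 1 gives \<delta>^2 \<le> \<delta>; the 5 instead of 4 makes the
      inequality needed by \<open>close\<close> strict.\<close>
    define \<delta> where "\<delta> = min 1 (e\<^sup>2 / (8 * d + 5))"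
    have \<delta>: "\<delta> > 0" "\<delta> \<le> 1" "\<delta> \<le> e\<^sup>2 / (8 * d + 5)"
      using \<open>e > 0\<close> \<open>d \<ge> 0\<close> by (simp_all add: \<delta>_def)
    then have "\<delta> * (8 * d + 5) \<le> e\<^sup>2" using \<open>d \<ge> 0\<close> by (simp add: pos_le_divide_eq)
    with \<delta>(1) have \<delta>': "\<delta> * (8 * d + 4) < e\<^sup>2" by (simp add: algebra_simps)
    obtain N where N: "inverse (real (Suc N)) < \<delta>" using reals_Archimedean[OF \<delta>(1)] by blast
    have "dist h (x n) < d + \<delta>" if "n \<ge> N" for n
    proof -
      have "inverse (real (Suc n)) \<le> inverse (real (Suc N))" using that by simp
      with x(2)[of n] N show ?thesis by linarith
    qed
    then have "dist (x m) (x n) < e" if "m \<ge> N" "n \<ge> N" for m n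
      using close[OF \<open>e > 0\<close> \<delta>(1,2) \<delta>', of m n] that \<open>e > 0\<close>
      by (auto intro: power2_less_imp_less)
    then show "\<exists>M. \<forall>m\<ge>M. \<forall>n\<ge>M. dist (x m) (x n) < e" by blast
  qed
  then obtain p where p: "x \<longlonglongrightarrow> p" using Cauchy_convergent convergent_def by blast
  have "p \<in> S" using closed_sequentially[OF assms(2) _ p] x(1) by simp
  moreover have "dist h p \<le> d"
  proof (rule LIMSEQ_le)
    show "(\<lambda>n. dist h (x n)) \<longlonglongrightarrow> dist h p" by (intro tendsto_intros p)
    show "(\<lambda>n. d + inverse (real (Suc n))) \<longlonglongrightarrow> d"
      using tendsto_add[OF tendsto_const LIMSEQ_inverse_real_of_nat, of d] by simp
    show "\<exists>N. \<forall>n\<ge>N. dist h (x n) \<le> d + inverse (real (Suc n))"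
      using x(2) less_imp_le by blast
  qed
  ultimately show ?thesis using d_le by (meson order_trans)
qed

lemma projection_closest:
  fixes S :: "'a::{real_inner, complete_space} set"
  assumes "convex S" "closed S" "S \<noteq> {}"
  shows "projection S h \<in> S" "q \<in> S \<Longrightarrow> dist h (projection S h) \<le> dist h q"
  using someI_ex[OF closest_point_exists_Hilbert[OF assms, of h, unfolded Bex_def]]
  unfolding projection_def by auto

lemma projection_dot:
  fixes S :: "'a::{real_inner, complete_space} set"
  assumes "convex S" "closed S" "q \<in> S"
  shows "(h - projection S h) \<bullet> (q - projection S h) \<le> 0"
proof -
  have "S \<noteq> {}" using assms(3) by auto
  then show ?thesis
    using projection_closest[OF assms(1,2)] any_closest_point_dot[OF assms(1,2) _ assms(3)] by blast
qed

text \<open>Add the obtuse-angle inequalities at the two projections, each tested with the other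
  one, and apply Cauchy-Schwarz.\<close>

lemma projection_nonexpansive:
  fixes S :: "'a::{real_inner, complete_space} set"
  assumes "convex S" "closed S" "S \<noteq> {}"
  shows "dist (projection S x) (projection S y) \<le> dist x y"
proof -
  let ?p = "projection S x" and ?q = "projection S y"
  have "(x - ?p) \<bullet> (?q - ?p) \<le> 0" "(y - ?q) \<bullet> (?p - ?q) \<le> 0"
    using projection_dot[OF assms(1,2)] projection_closest(1)[OF assms] by auto
  then have "norm (?p - ?q) * norm (?p - ?q) \<le> (x - y) \<bullet> (?p - ?q)"
    unfolding power2_eq_square[symmetric] power2_norm_eq_inner
    by (simp add: algebra_simps inner_commute)
  also have "\<dots> \<le> norm (x - y) * norm (?p - ?q)" by (rule norm_cauchy_schwarz)
  finally show ?thesis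
    by (cases "norm (?p - ?q) = 0") (auto simp: dist_norm)
qed

section \<open>Riesz representation and coercive variational inequalities\<close>

text \<open>The point \<open>p\<close> of least norm in the hyperplane g = 1 is orthogonal to the
  kernel of \<open>g\<close>, so p / |p|^2 represents \<open>g\<close>.\<close>

lemma Riesz_representation_Hilbert:
  fixes g :: "'a::{real_inner, complete_space} \<Rightarrow>\<^sub>L real"
  shows "\<exists>y. \<forall>v. y \<bullet> v = blinfun_apply g v"
proof (cases "g = 0")
  case True
  then show ?thesis by (intro exI[of _ 0]) simp
next
  case False
  then obtain u where u: "blinfun_apply g u \<noteq> 0"
    by (metis blinfun_eqI zero_blinfun.rep_eq)
  define S where "S = {v. blinfun_apply g v = 1}"
  have S: "convex S" "closed S"
    unfolding S_def
    by (auto simp: convex_def blinfun.add_right blinfun.scaleR_right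
        intro!: closed_Collect_eq continuous_intros)
  have "(1 / blinfun_apply g u) *\<^sub>R u \<in> S" using u by (simp add: S_def blinfun.scaleR_right)
  then have "S \<noteq> {}" by auto
  define p where "p = projection S 0"
  have "p \<in> S" unfolding p_def by (rule projection_closest(1)[OF S \<open>S \<noteq> {}\<close>])
  then have gp: "blinfun_apply g p = 1" by (simp add: S_def)
  then have "p \<noteq> 0" by auto
  have ker: "p \<bullet> k = 0" if "blinfun_apply g k = 0" for k
  proof -
    have "p + k \<in> S" "p - k \<in> S" using gp that by (auto simp: S_def blinfun.add_right blinfun.diff_right)
    from this[THEN projection_dot[OF S, of _ 0]] show ?thesis by (simp add: p_def)
  qed
  have *: "p \<bullet> v = blinfun_apply g v * (p \<bullet> p)" for v
    using ker[of "v - blinfun_apply g v *\<^sub>R p"] gp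
    by (simp add: blinfun.diff_right blinfun.scaleR_right inner_diff_right)
  show ?thesis
  proof (intro exI allI)
    fix v
    show "((1 / (p \<bullet> p)) *\<^sub>R p) \<bullet> v = blinfun_apply g v"
      using *[of v] \<open>p \<noteq> 0\<close> by simp
  qed
qed

text \<open>A solution is a fixed point of \<open>G\<close>, a gradient-like step of length \<rho>
  followed by projection onto \<open>K\<close>; boundedness and coercivity make \<open>G\<close> a
  contraction for a suitable \<rho>.\<close>

lemma Lions_Stampacchia:
  fixes A :: "'a::{real_inner, complete_space} \<Rightarrow> 'a \<Rightarrow>\<^sub>L real"
  assumes "linear A"
    and Cb: "Cb > 0" "\<And>u v. blinfun_apply (A u) v \<le> Cb * norm u * norm v"
    and Ca: "Ca > 0" "\<And>u. blinfun_apply (A u) u \<ge> Ca * (norm u)\<^sup>2"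
    and K: "convex K" "closed K" "K \<noteq> {}"
  shows "\<exists>y\<in>K. \<forall>v\<in>K. blinfun_apply (A y - f) (y - v) \<le> 0"
proof -
  obtain R :: "('a \<Rightarrow>\<^sub>L real) \<Rightarrow> 'a" where R: "\<And>g v. R g \<bullet> v = blinfun_apply g v"
    using Riesz_representation_Hilbert by metis
  have normRA: "norm (R (A w)) \<le> Cb * norm w" for w
  proof -
    have "norm (R (A w)) * norm (R (A w)) = blinfun_apply (A w) (R (A w))"
      unfolding R[symmetric] by (simp add: power2_norm_eq_inner[symmetric] power2_eq_square)
    also have "\<dots> \<le> (Cb * norm w) * norm (R (A w))" by (rule Cb)
    finally show ?thesis using Cb(1)
      by (cases "norm (R (A w)) = 0") auto
  qed
  \<comment> \<open>This \<rho> minimizes 1 - 2 \<rho> Ca + \<rho>^2 Cb^2, the factor that bounds |w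
    - \<rho> R(A w)|^2 / |w|^2; the minimum is 1 - Ca^2 / Cb^2.\<close>
  define \<rho> where "\<rho> = Ca / Cb\<^sup>2"
  \<comment> \<open>\<open>Ca \<le> Cb\<close> may fail when the space is trivial, hence the maximum.\<close>
  define k where "k = sqrt (max 0 (1 - Ca\<^sup>2 / Cb\<^sup>2))"
  have k: "0 \<le> k" "k < 1" using Ca(1) Cb(1) by (auto simp: k_def)
  have "\<rho> > 0" using Ca(1) Cb(1) by (simp add: \<rho>_def)
  have contr: "norm (w - \<rho> *\<^sub>R R (A w)) \<le> k * norm w" for w
  proof (rule power2_le_imp_le)
    have "(norm (w - \<rho> *\<^sub>R R (A w)))\<^sup>2
        = (norm w)\<^sup>2 - 2 * \<rho> * blinfun_apply (A w) w + \<rho>\<^sup>2 * (norm (R (A w)))\<^sup>2"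
      unfolding R[symmetric] power2_norm_eq_inner
      by (simp add: algebra_simps inner_commute power2_eq_square)
    also have "\<dots> \<le> (norm w)\<^sup>2 - 2 * \<rho> * (Ca * (norm w)\<^sup>2) + \<rho>\<^sup>2 * (Cb * norm w)\<^sup>2"
      using Ca(2)[of w] power_mono[OF normRA[of w], of 2] \<open>\<rho> > 0\<close>
      by (intro add_mono diff_mono mult_left_mono) auto
    also have "\<dots> = (1 - Ca\<^sup>2 / Cb\<^sup>2) * (norm w)\<^sup>2"
      using Cb(1) by (simp add: \<rho>_def power2_eq_square field_simps)
    also have "\<dots> \<le> k\<^sup>2 * (norm w)\<^sup>2"
      by (intro mult_right_mono) (auto simp: k_def)
    finally show "(norm (w - \<rho> *\<^sub>R R (A w)))\<^sup>2 \<le> (k * norm w)\<^sup>2"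
      by (simp add: power_mult_distrib)
    show "0 \<le> k * norm w" using k by simp
  qed
  have R_diff: "R (g - h) = R g - R h" for g h
    by (rule vector_eq_rdot[THEN iffD1, rule_format])
      (simp add: R inner_diff_left blinfun.diff_left)
  define G where "G u = projection K (u - \<rho> *\<^sub>R R (A u - f))" for u
  have "dist (G u) (G v) \<le> k * dist u v" for u v
  proof -
    have "dist (G u) (G v) \<le> norm ((u - v) - \<rho> *\<^sub>R R (A (u - v)))"
      unfolding G_def using projection_nonexpansive[OF K]
      by (rule order_trans)
        (simp add: dist_norm R_diff linear_diff[OF \<open>linear A\<close>] algebra_simps)
    also have "\<dots> \<le> k * norm (u - v)" by (rule contr)
    finally show ?thesis by (simp add: dist_norm)
  qed
  then obtain y where y: "G y = y" using banach_fix_type[OF k, of G] by blast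
  have "y \<in> K" using projection_closest(1)[OF K] y by (metis G_def)
  moreover have "blinfun_apply (A y - f) (y - v) \<le> 0" if "v \<in> K" for v
  proof -
    \<comment> \<open>At a fixed point of \<open>G\<close>, the obtuse-angle property of the
      projection is the variational inequality scaled by \<rho>.\<close>
    have "((y - \<rho> *\<^sub>R R (A y - f)) - y) \<bullet> (v - y) \<le> 0"
      using projection_dot[OF K(1,2) that, of "y - \<rho> *\<^sub>R R (A y - f)"] y by (simp add: G_def)
    then have "\<rho> * (R (A y - f) \<bullet> (y - v)) \<le> 0" by (simp add: algebra_simps)
    then show ?thesis using \<open>\<rho> > 0\<close> R by (simp add: mult_le_0_iff)
  qed
  ultimately show ?thesis by blast
qed

text \<open>On the whole space, the test points y - v and y + v turn the variational inequality into
  an equation. Surjectivity is what gives \<open>inv A F\<close> its meaning.\<close>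

lemma Lax_Milgram_surj:
  fixes A :: "'a::{real_inner, complete_space} \<Rightarrow> 'a \<Rightarrow>\<^sub>L real"
  assumes "linear A"
    and "Cb > 0" "\<And>u v. blinfun_apply (A u) v \<le> Cb * norm u * norm v"
    and "Ca > 0" "\<And>u. blinfun_apply (A u) u \<ge> Ca * (norm u)\<^sup>2"
  shows "surj A"
proof -
  have "\<exists>y. A y = F" for F
  proof -
    obtain y where y: "\<And>v. blinfun_apply (A y - F) (y - v) \<le> 0"
      using Lions_Stampacchia[OF assms, of UNIV F] by auto
    have "blinfun_apply (A y - F) v = 0" for v
      using y[of "y - v"] y[of "y + v"] by (simp add: blinfun.minus_right)
    then have "A y - F = 0" by (intro blinfun_eqI) simp
    then show ?thesis by auto
  qed
  then show ?thesis by (metis surjI)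
qed

section \<open>Self-dual lattice cones\<close>

locale self_dual_lattice_cone =
  fixes C :: "'h::{real_inner, complete_space} set"
  assumes self_dual: "self_dual C" and lattice: "vector_lattice C"
begin

lemma mem_iff: "h \<in> C \<longleftrightarrow> (\<forall>g\<in>C. h \<bullet> g \<ge> 0)"
  using self_dual unfolding self_dual_def by blast

lemma inner_nonneg: "h \<in> C \<Longrightarrow> g \<in> C \<Longrightarrow> h \<bullet> g \<ge> 0"
  using mem_iff by blast

lemma zero_mem: "0 \<in> C"
  by (subst mem_iff) simp

lemma add_mem: "h \<in> C \<Longrightarrow> g \<in> C \<Longrightarrow> h + g \<in> C"
  by (subst mem_iff) (simp add: inner_add_left inner_nonneg)

lemma scaleR_mem: "h \<in> C \<Longrightarrow> t \<ge> 0 \<Longrightarrow> t *\<^sub>R h \<in> C"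
  by (subst mem_iff) (simp add: inner_nonneg)

lemma convex_C: "convex C"
  by (intro convexI add_mem scaleR_mem)

lemma closed_C: "closed C"
proof -
  have "C = (\<Inter>g\<in>C. {h. h \<bullet> g \<ge> 0})" using mem_iff by blast
  moreover have "closed (\<Inter>g\<in>C. {h. h \<bullet> g \<ge> 0})"
    by (intro closed_INT ballI closed_Collect_le continuous_intros)
  ultimately show ?thesis by simp
qed

lemma le_refl: "cone_le C x x"
  by (simp add: cone_le_def zero_mem)

lemma le_trans: "cone_le C x y \<Longrightarrow> cone_le C y z \<Longrightarrow> cone_le C x z"
  unfolding cone_le_def using add_mem[of "y - x" "z - y"] by simp

lemma le_antisym: "cone_le C x y \<Longrightarrow> cone_le C y x \<Longrightarrow> x = y"
proof -
  assume "cone_le C x y" "cone_le C y x"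
  then have "(y - x) \<bullet> (x - y) \<ge> 0" by (intro inner_nonneg) (simp_all add: cone_le_def)
  then have "(y - x) \<bullet> (y - x) \<le> 0" by (simp add: algebra_simps)
  then show "x = y" by (simp flip: power2_norm_eq_inner)
qed

section \<open>Moreau decomposition and the lattice positive part\<close>

text \<open>Moreau decomposition. Testing the projection inequality with 0 and 2p gives
  orthogonality; testing with arbitrary cone elements puts p - h in the dual cone, which is
  \<open>C\<close> itself.\<close>

lemma projection_decomposition:
  shows "projection C h \<in> C" "projection C h - h \<in> C"
    and "projection C h \<bullet> (projection C h - h) = 0"
proof -
  let ?p = "projection C h"
  note dot = projection_dot[OF convex_C closed_C, of _ h]
  show p: "?p \<in> C" using projection_closest(1)[OF convex_C closed_C] zero_mem by blast
  show orth: "?p \<bullet> (?p - h) = 0"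
    using dot[OF zero_mem] dot[OF add_mem[OF p p]] by (simp add: algebra_simps inner_commute)
  show "?p - h \<in> C"
  proof (subst mem_iff, rule ballI)
    fix g assume "g \<in> C"
    from dot[OF this] orth show "(?p - h) \<bullet> g \<ge> 0" by (simp add: algebra_simps inner_commute)
  qed
qed

text \<open>Uniqueness of the Moreau decomposition: |p - q|^2 expands into cross terms that are
  nonpositive by self-duality.\<close>

lemma projection_eqI:
  assumes "q \<in> C" "q - h \<in> C" "q \<bullet> (q - h) = 0"
  shows "projection C h = q"
proof -
  let ?p = "projection C h"
  have "(?p - q) \<bullet> (?p - q) = - (?p \<bullet> (q - h)) - q \<bullet> (?p - h)"
    using assms(3) projection_decomposition(3)[of h] by (simp add: algebra_simps inner_commute)
  moreover have "?p \<bullet> (q - h) \<ge> 0" "q \<bullet> (?p - h) \<ge> 0"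
    using assms projection_decomposition[of h] by (auto intro: inner_nonneg)
  ultimately have "(?p - q) \<bullet> (?p - q) \<le> 0" by linarith
  then show ?thesis by (simp flip: power2_norm_eq_inner)
qed

lemma projection_uminus: "projection C (- h) = projection C h - h"
  using projection_decomposition[of h]
  by (intro projection_eqI) (simp_all add: inner_commute[of "projection C h - h" "projection C h"])

text \<open>The lattice supremum \<open>s\<close> of h and 0 satisfies the Moreau conditions. Since
  p is an upper bound of both, s \<le> p, and the two resulting inner products force s to be
  orthogonal to s - h; hence p = s.\<close>

lemma projection_least:
  assumes "z \<in> C" "z - h \<in> C"
  shows "z - projection C h \<in> C"
proof -
  obtain inf sup where
    "class.lattice inf (cone_le C) (\<lambda>x y. cone_le C x y \<and> \<not> cone_le C y x) sup"
    using lattice unfolding vector_lattice_def by blast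
  then interpret L: lattice inf "cone_le C" "\<lambda>x y. cone_le C x y \<and> \<not> cone_le C y x" sup .
  define s where "s = sup h 0"
  have s: "s - h \<in> C" "s \<in> C"
    using L.sup_ge1[of h 0] L.sup_ge2[of 0 h] by (simp_all add: s_def cone_le_def)
  have least: "w - s \<in> C" if "w \<in> C" "w - h \<in> C" for w
    using L.sup_least[of h w 0] that by (simp add: s_def cone_le_def)
  let ?p = "projection C h"
  note p = projection_decomposition[of h]
  have "(?p - s) \<bullet> (s - h) \<ge> 0" "?p \<bullet> (?p - s) \<ge> 0"
    using least[OF p(1,2)] p(1) s by (auto intro: inner_nonneg)
  then have "s \<bullet> (s - h) \<le> 0" using p(3) by (simp add: algebra_simps)
  with inner_nonneg[OF s(2,1)] have "projection C h = s"
    using s by (intro projection_eqI) auto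
  with least[OF assms] show ?thesis by simp
qed

section \<open>Order completeness and fixed points of increasing maps\<close>

text \<open>Let \<open>p\<close> be the upper bound closest to \<open>a\<close>. For another upper
  bound \<open>u\<close>, the infimum q of p and u satisfies a \<le> q \<le> p, so |p - a|^2 is at
  least |q - a|^2 + |p - q|^2. Minimality forces q = p, that is p \<le> u.\<close>

lemma ex_least_upper_bound:
  assumes "x\<^sub>0 \<in> P" and lower: "\<And>x. x \<in> P \<Longrightarrow> cone_le C a x" and upper: "\<And>x. x \<in> P \<Longrightarrow> cone_le C x b"
  shows "\<exists>p. (\<forall>x\<in>P. cone_le C x p) \<and> (\<forall>u. (\<forall>x\<in>P. cone_le C x u) \<longrightarrow> cone_le C p u)"
proof -
  define U where "U = (\<Inter>x\<in>P. (\<lambda>u. u - x) -` C)"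
  have U_iff: "u \<in> U \<longleftrightarrow> (\<forall>x\<in>P. cone_le C x u)" for u
    by (auto simp: U_def cone_le_def)
  have "closed U"
    unfolding U_def by (intro closed_INT ballI closed_vimage closed_C continuous_intros)
  moreover have "convex U"
  proof (rule convexI)
    fix y z :: 'h and s t :: real
    assume *: "y \<in> U" "z \<in> U" "0 \<le> s" "0 \<le> t" "s + t = 1"
    have "s *\<^sub>R y + t *\<^sub>R z - x = s *\<^sub>R (y - x) + t *\<^sub>R (z - x)" for x
      using \<open>s + t = 1\<close> by (simp add: algebra_simps flip: scaleR_add_left)
    then show "s *\<^sub>R y + t *\<^sub>R z \<in> U"
      using * by (simp add: U_def add_mem scaleR_mem)
  qed
  moreover have "b \<in> U" using upper by (simp add: U_iff)
  ultimately obtain p where p: "p \<in> U" and closest: "\<And>q. q \<in> U \<Longrightarrow> dist a p \<le> dist a q"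
    using closest_point_exists_Hilbert[of U a] by blast
  have "cone_le C p u" if "u \<in> U" for u
  proof -
    \<comment> \<open>\<open>q\<close> is the infimum of \<open>p\<close> and \<open>u\<close>.\<close>
    define q where "q = p - projection C (p - u)"
    have "q \<in> U"
      unfolding U_iff
    proof
      fix x assume "x \<in> P"
      then have "p - x \<in> C" "u - x \<in> C" using p \<open>u \<in> U\<close> by (auto simp: U_def)
      \<comment> \<open>p - x dominates both 0 and p - u, hence also the positive part of p -
        u.\<close>
      then show "cone_le C x q"
        using projection_least[of "p - x" "p - u"] by (simp add: q_def cone_le_def algebra_simps)
    qed
    then have "cone_le C a q" using lower \<open>x\<^sub>0 \<in> P\<close> le_trans U_iff by blast
    then have "(q - a) \<bullet> (p - q) \<ge> 0"
      using projection_decomposition(1) by (intro inner_nonneg) (auto simp: q_def cone_le_def)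
    moreover have "(p - a) \<bullet> (p - a) \<le> (q - a) \<bullet> (q - a)"
      using power_mono[OF closest[OF \<open>q \<in> U\<close>], of 2]
      by (simp add: dist_norm norm_minus_commute flip: power2_norm_eq_inner)
    ultimately have "(p - q) \<bullet> (p - q) \<le> 0"
      by (simp add: algebra_simps inner_commute)
    then have "q = p" by (simp flip: power2_norm_eq_inner)
    then show ?thesis
      using projection_decomposition(2)[of "p - u"] by (simp add: q_def cone_le_def)
  qed
  with p show ?thesis using U_iff by blast
qed

text \<open>Knaster-Tarski: \<open>p\<close> is the supremum of the set \<open>P\<close> of points x
  \<le> T x in the interval. \<open>T p\<close> again belongs to \<open>P\<close>, which gives the
  missing inequality T p \<le> p.\<close>

lemma ex_greatest_fixpoint:
  assumes mono: "monotone (cone_le C) (cone_le C) T"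
    and a: "cone_le C a (T a)" and b: "cone_le C (T b) b" and "cone_le C a b"
  shows "\<exists>p. T p = p \<and> cone_le C a p \<and> cone_le C p b \<and>
    (\<forall>x. T x = x \<longrightarrow> cone_le C a x \<longrightarrow> cone_le C x b \<longrightarrow> cone_le C x p)"
proof -
  define P where "P = {x. cone_le C a x \<and> cone_le C x b \<and> cone_le C x (T x)}"
  have "a \<in> P" using assms le_refl by (simp add: P_def)
  obtain p where p: "\<And>x. x \<in> P \<Longrightarrow> cone_le C x p"
    and least: "\<And>u. (\<And>x. x \<in> P \<Longrightarrow> cone_le C x u) \<Longrightarrow> cone_le C p u"
    using ex_least_upper_bound[OF \<open>a \<in> P\<close>, of a b] unfolding P_def by blast
  have ap: "cone_le C a p" using p \<open>a \<in> P\<close> by blast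
  have pb: "cone_le C p b" using least unfolding P_def by blast
  have "cone_le C x (T p)" if "x \<in> P" for x
    using that p[OF that] monotoneD[OF mono] le_trans unfolding P_def by blast
  then have pT: "cone_le C p (T p)" using least by blast
  have "cone_le C a (T p)" "cone_le C (T p) b" "cone_le C (T p) (T (T p))"
    using ap pb a b pT monotoneD[OF mono] le_trans by blast+
  then have "T p = p" using p pT le_antisym unfolding P_def by blast
  moreover have "cone_le C x p" if "T x = x" "cone_le C a x" "cone_le C x b" for x
    using p that le_refl unfolding P_def by simp
  ultimately show ?thesis using ap pb by blast
qed

lemma uminus_le_uminus: "cone_le C (- x) (- y) \<longleftrightarrow> cone_le C y x"
  by (simp add: cone_le_def)

text \<open>Conjugation by x -> -x reverses the order and exchanges the roles of \<open>a\<close>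
  and \<open>b\<close>.\<close>

lemma ex_least_fixpoint:
  assumes mono: "monotone (cone_le C) (cone_le C) T"
    and a: "cone_le C a (T a)" and b: "cone_le C (T b) b" and "cone_le C a b"
  shows "\<exists>p. T p = p \<and> cone_le C a p \<and> cone_le C p b \<and>
    (\<forall>x. T x = x \<longrightarrow> cone_le C a x \<longrightarrow> cone_le C x b \<longrightarrow> cone_le C p x)"
proof -
  have "monotone (cone_le C) (cone_le C) (\<lambda>x. - T (- x))"
    using monotoneD[OF mono] by (intro monotoneI) (simp add: uminus_le_uminus)
  from ex_greatest_fixpoint[OF this, of "- b" "- a"]
  obtain p where p: "- T (- p) = p" "cone_le C (- b) p" "cone_le C p (- a)"
    and greatest: "\<And>x. - T (- x) = x \<Longrightarrow> cone_le C (- b) x \<Longrightarrow> cone_le C x (- a) \<Longrightarrow> cone_le C x p"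
    using assms by (auto simp: uminus_le_uminus)
  have "T (- p) = - p" using p(1) by (metis minus_minus)
  moreover have "cone_le C a (- p)" "cone_le C (- p) b"
    using p(2,3) uminus_le_uminus[of b "- p"] uminus_le_uminus[of "- p" a] by simp_all
  moreover have "cone_le C (- p) x" if "T x = x" "cone_le C a x" "cone_le C x b" for x
    using greatest[of "- x"] that uminus_le_uminus[of x "- p"] by (simp add: uminus_le_uminus)
  ultimately show ?thesis by blast
qed

end

section \<open>The obstacle problem\<close>

locale obstacle_problem = self_dual_lattice_cone C
  for C :: "'h::{real_inner, complete_space} set" +
  fixes \<iota> :: "'v::{real_inner, complete_space} \<Rightarrow> 'h"
    and A :: "'v \<Rightarrow> 'v \<Rightarrow>\<^sub>L real"
    and Ca Cb :: real
  assumes bounded_linear: "bounded_linear \<iota>" and inj: "inj \<iota>"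
    and projection_range: "\<And>v. projection C (\<iota> v) \<in> range \<iota>"
    and linear: "linear A"
    and Cb: "Cb > 0" "\<And>u v. blinfun_apply (A u) v \<le> Cb * norm u * norm v"
    and Ca: "Ca > 0" "\<And>u. blinfun_apply (A u) u \<ge> Ca * (norm u)\<^sup>2"
    and pos_neg: "\<And>u. blinfun_apply (A (pos_part C \<iota> u)) (neg_part C \<iota> u) \<le> 0"
begin

abbreviation le (infix "\<preceq>" 50) where "u \<preceq> v \<equiv> V_le C \<iota> u v"

text \<open>The quasi-variational inequality with its obstacle frozen: \<open>qvi_solution\<close>
  is the case \<psi> = \<open>\<Phi> (\<iota> y)\<close>.\<close>

definition solves :: "('v \<Rightarrow>\<^sub>L real) \<Rightarrow> 'v \<Rightarrow> 'v \<Rightarrow> bool" where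
  "solves f \<psi> y \<longleftrightarrow> y \<preceq> \<psi> \<and> (\<forall>v. v \<preceq> \<psi> \<longrightarrow> blinfun_apply (A y - f) (y - v) \<le> 0)"

lemma solves_obstacle: "solves f \<psi> y \<Longrightarrow> y \<preceq> \<psi>"
  by (simp only: solves_def)

lemma solves_variational:
  "solves f \<psi> y \<Longrightarrow> v \<preceq> \<psi> \<Longrightarrow> blinfun_apply (A y - f) (y - v) \<le> 0"
  by (simp only: solves_def)

section \<open>Order and positive parts in V\<close>

lemma embedding_diff: "\<iota> (u - v) = \<iota> u - \<iota> v"
  using bounded_linear by (rule bounded_linear.linear[THEN linear_diff])

lemma embedding_add: "\<iota> (u + v) = \<iota> u + \<iota> v"
  using bounded_linear by (rule bounded_linear.linear[THEN linear_add])

lemma embedding_scaleR: "\<iota> (t *\<^sub>R v) = t *\<^sub>R \<iota> v"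
  using bounded_linear by (rule bounded_linear.linear[THEN linear_scale])

lemma V_le_iff: "u \<preceq> v \<longleftrightarrow> \<iota> (v - u) \<in> C"
  by (simp add: V_le_def cone_le_def embedding_diff)

lemma V_le_refl: "u \<preceq> u"
  by (simp add: V_le_def le_refl)

lemma V_le_trans: "u \<preceq> v \<Longrightarrow> v \<preceq> w \<Longrightarrow> u \<preceq> w"
  unfolding V_le_def by (rule le_trans)

lemma V_le_antisym: "u \<preceq> v \<Longrightarrow> v \<preceq> u \<Longrightarrow> u = v"
  unfolding V_le_def by (rule injD[OF inj le_antisym])

lemma embedding_pos_part: "\<iota> (pos_part C \<iota> v) = projection C (\<iota> v)"
  unfolding pos_part_def using projection_range by (rule f_inv_into_f)

lemma pos_part_nonneg: "0 \<preceq> pos_part C \<iota> v"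
  by (simp add: V_le_iff embedding_pos_part projection_decomposition)

lemma diff_pos_part_le: "u - pos_part C \<iota> v \<preceq> u"
  by (simp add: V_le_iff embedding_pos_part projection_decomposition)

text \<open>u + (v - u)^+ is the supremum of u and v. It serves as an admissible test function in
  comparison arguments.\<close>

lemma add_pos_part_le: "u \<preceq> \<psi> \<Longrightarrow> v \<preceq> \<psi> \<Longrightarrow> u + pos_part C \<iota> (v - u) \<preceq> \<psi>"
  using projection_least[of "\<iota> (\<psi> - u)" "\<iota> (v - u)"]
  by (simp add: V_le_iff embedding_diff embedding_add embedding_pos_part algebra_simps)

lemma pos_part_uminus: "pos_part C \<iota> (- v) = neg_part C \<iota> v"
proof -
  have "\<iota> (pos_part C \<iota> (- v)) = \<iota> (neg_part C \<iota> v)"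
    using embedding_diff[of 0 v] embedding_diff[of 0 0]
    by (simp add: embedding_pos_part neg_part_def embedding_diff projection_uminus)
  then show ?thesis using inj by (rule injD[rotated])
qed

lemma neg_part_uminus: "neg_part C \<iota> (- v) = pos_part C \<iota> v"
  unfolding neg_part_def by (simp add: pos_part_uminus) (simp add: neg_part_def)

section \<open>Comparison principles and the obstacle solution map\<close>

text \<open>Split w = u - v into w^+ - w^-. The cross term -\<langle>A w^-, w^+\<rangle> is
  nonnegative, so coercivity forces w^+ = 0.\<close>

lemma T_monotone:
  assumes "blinfun_apply (A (u - v)) (pos_part C \<iota> (u - v)) \<le> 0"
  shows "u \<preceq> v"
proof -
  let ?p = "pos_part C \<iota> (u - v)" and ?n = "neg_part C \<iota> (u - v)"
  have "u - v = ?p - ?n" by (simp add: neg_part_def)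
  then have "blinfun_apply (A (u - v)) ?p = blinfun_apply (A ?p) ?p - blinfun_apply (A ?n) ?p"
    by (metis linear linear_diff blinfun.diff_left)
  \<comment> \<open>The hypothesis has the parts in the other order; passing to -(u - v) swaps
    them.\<close>
  moreover have "blinfun_apply (A ?n) ?p \<le> 0"
    using pos_neg[of "- (u - v)"] unfolding pos_part_uminus neg_part_uminus .
  moreover have "Ca * (norm ?p)\<^sup>2 \<le> blinfun_apply (A ?p) ?p" by (rule Ca)
  ultimately have "Ca * (norm ?p)\<^sup>2 \<le> 0" using assms by linarith
  then have "?p = 0" using Ca(1) by (simp add: mult_le_0_iff)
  then show ?thesis
    using projection_decomposition(2)[of "\<iota> (u - v)"] embedding_pos_part[of "u - v"]
      embedding_diff[of 0 "u - v"] embedding_diff[of 0 0]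
    by (simp add: V_le_iff embedding_diff)
qed

text \<open>Lions-Stampacchia on the set \<open>K\<close> below the obstacle, which is closed as a
  preimage of the cone and contains \<psi>.\<close>

lemma solves_exists: "\<exists>y. solves f \<psi> y"
proof -
  define K where "K = {v. v \<preceq> \<psi>}"
  have "closed ((\<lambda>v. \<iota> (\<psi> - v)) -` C)"
    by (intro closed_vimage closed_C continuous_intros
        linear_continuous_on[OF bounded_linear, THEN continuous_on_compose2]) auto
  moreover have "(\<lambda>v. \<iota> (\<psi> - v)) -` C = K" by (auto simp: K_def V_le_iff)
  moreover have "convex K"
  proof (rule convexI)
    fix y z :: 'v and s t :: real
    assume *: "y \<in> K" "z \<in> K" "0 \<le> s" "0 \<le> t" "s + t = 1"
    have "\<psi> - (s *\<^sub>R y + t *\<^sub>R z) = s *\<^sub>R (\<psi> - y) + t *\<^sub>R (\<psi> - z)"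
      using \<open>s + t = 1\<close> by (simp add: algebra_simps flip: scaleR_add_left)
    then show "s *\<^sub>R y + t *\<^sub>R z \<in> K"
      using * by (simp add: K_def V_le_iff embedding_add embedding_scaleR add_mem scaleR_mem)
  qed
  moreover have "K \<noteq> {}" using V_le_refl by (auto simp: K_def)
  ultimately have "\<exists>y\<in>K. \<forall>v\<in>K. blinfun_apply (A y - f) (y - v) \<le> 0"
    by (intro Lions_Stampacchia[OF linear Cb Ca]) auto
  then show ?thesis unfolding solves_def K_def by blast
qed

text \<open>Testing with the supremum of u and y bounds the residual of y from below on (u - y)^+;
  subtracting gives the premise of \<open>T_monotone\<close>.\<close>

lemma subsolution_le_solution:
  assumes "solves f \<psi> y" "u \<preceq> \<psi>"
    and "blinfun_apply (A u - f) (pos_part C \<iota> (u - y)) \<le> 0"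
  shows "u \<preceq> y"
proof (rule T_monotone)
  let ?d = "pos_part C \<iota> (u - y)"
  have "blinfun_apply (A y - f) (y - (y + ?d)) \<le> 0"
    using solves_obstacle[OF assms(1)] assms(2)
    by (intro solves_variational[OF assms(1)] add_pos_part_le)
  then show "blinfun_apply (A (u - y)) ?d \<le> 0"
    using assms(3) by (simp add: linear_diff[OF linear] blinfun.diff_left blinfun.minus_right)
qed

text \<open>Lowering y keeps it below the obstacle, so y - w^+ is admissible. In effect A y \<le> f
  in the dual order.\<close>

lemma solution_residual_nonpos:
  assumes "solves f \<psi> y"
  shows "blinfun_apply (A y - f) (pos_part C \<iota> w) \<le> 0"
proof -
  have "y - pos_part C \<iota> w \<preceq> \<psi>"
    by (rule V_le_trans[OF diff_pos_part_le solves_obstacle[OF assms]])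
  then have "blinfun_apply (A y - f) (y - (y - pos_part C \<iota> w)) \<le> 0"
    by (rule solves_variational[OF assms])
  then show ?thesis by simp
qed

text \<open>By the sign of its residual, the first solution is a subsolution lying below the larger
  obstacle.\<close>

lemma solves_mono:
  assumes "solves f \<psi>1 y1" "solves f \<psi>2 y2" "\<psi>1 \<preceq> \<psi>2"
  shows "y1 \<preceq> y2"
  using assms(2) V_le_trans[OF solves_obstacle[OF assms(1)] assms(3)]
    solution_residual_nonpos[OF assms(1)]
  by (rule subsolution_le_solution)

lemma solves_unique: "solves f \<psi> y1 \<Longrightarrow> solves f \<psi> y2 \<Longrightarrow> y1 = y2"
  by (intro V_le_antisym) (rule solves_mono[OF _ _ V_le_refl]; assumption)+

text \<open>Test A y \<le> f \<le> A b with (y - b)^+. The bound is independent of the obstacle, so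
  it holds for every value of the solution map.\<close>

lemma solution_le_supersolution:
  assumes "solves f \<psi> y" "dual_le C \<iota> f (A b)"
  shows "y \<preceq> b"
proof (rule T_monotone)
  let ?d = "pos_part C \<iota> (y - b)"
  have "blinfun_apply (A b - f) ?d \<ge> 0"
    using assms(2)[unfolded dual_le_def, rule_format, OF pos_part_nonneg] .
  then show "blinfun_apply (A (y - b)) ?d \<le> 0"
    using solution_residual_nonpos[OF assms(1), of "y - b"]
    by (simp add: linear_diff[OF linear] blinfun.diff_left)
qed

end

section \<open>Solutions of the quasi-variational inequality as fixed points\<close>

theorem theorem2p10:
  fixes \<iota> :: "'v::{real_inner, complete_space} \<Rightarrow> 'h::{real_inner, complete_space}"
    and C :: "'h set"
    and A :: "'v \<Rightarrow> 'v \<Rightarrow>\<^sub>L real"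
    and \<Phi> :: "'h \<Rightarrow> 'v"
    and f F :: "'v \<Rightarrow>\<^sub>L real"
    and v\<^sub>0 :: 'v
    and c C\<^sub>a C\<^sub>b :: real
  assumes "dense_embedding \<iota>"
    and "closed C" and "convex_cone C" and "self_dual C" and "vector_lattice C"
    and "\<And>v. projection C (\<iota> v) \<in> range \<iota>"
    and "c > 0" and "\<And>v. norm (pos_part C \<iota> v) \<le> c * norm v"
    and "linear A"
    and "C\<^sub>b > 0" and "\<And>u v. blinfun_apply (A u) v \<le> C\<^sub>b * norm u * norm v"
    and "C\<^sub>a > 0" and "\<And>u. blinfun_apply (A u) u \<ge> C\<^sub>a * (norm u)\<^sup>2"
    and "\<And>u. blinfun_apply (A (pos_part C \<iota> u)) (neg_part C \<iota> u) \<le> 0"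
    and "monotone (cone_le C) (V_le C \<iota>) \<Phi>"
    and "V_le C \<iota> v\<^sub>0 (\<Phi> (\<iota> v\<^sub>0))"
    and "dual_le C \<iota> (A v\<^sub>0) f" and "dual_le C \<iota> f F"
  defines "S \<equiv> {y. qvi_solution C \<iota> A \<Phi> f y \<and> V_le C \<iota> v\<^sub>0 y \<and> V_le C \<iota> y (inv A F)}"
  shows "S \<noteq> {} \<and>
    (\<exists>m\<in>S. \<forall>y\<in>S. V_le C \<iota> m y) \<and> (\<exists>M\<in>S. \<forall>y\<in>S. V_le C \<iota> y M)"
proof -
  have embedding: "bounded_linear \<iota>" "inj \<iota>"
    using assms(1) by (simp_all add: dense_embedding_def)
  interpret obstacle_problem C \<iota> A C\<^sub>a C\<^sub>b
    by (intro obstacle_problem.intro self_dual_lattice_cone.intro obstacle_problem_axioms.intro)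
      (fact assms embedding)+
  define b where "b = inv A F"
  have Ab: "A b = F"
    unfolding b_def by (rule surj_f_inv_f[OF Lax_Milgram_surj[OF linear Cb Ca]])
  define T where "T w = (SOME y. solves f (\<Phi> w) y)" for w
  have T: "solves f (\<Phi> w) (T w)" for w
    unfolding T_def by (rule someI_ex[OF solves_exists])
  have qvi_iff: "qvi_solution C \<iota> A \<Phi> f y \<longleftrightarrow> T (\<iota> y) = y" for y
    using T[of "\<iota> y"] solves_unique[OF T[of "\<iota> y"], of y]
    unfolding qvi_solution_def solves_def[symmetric] by auto
  \<comment> \<open>The fixed-point argument takes place in H, where order completeness is
    available, hence the composition with \<iota>.\<close>
  have mono: "monotone (cone_le C) (cone_le C) (\<lambda>w. \<iota> (T w))"
    using solves_mono[OF T T] monotoneD[OF assms(15)]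
    by (intro monotoneI) (simp add: V_le_def)
  have "blinfun_apply (A v\<^sub>0 - f) (pos_part C \<iota> w) \<le> 0" for w
    using assms(17) pos_part_nonneg[of w] by (auto simp: dual_le_def blinfun.diff_left)
  then have lo: "v\<^sub>0 \<preceq> T (\<iota> v\<^sub>0)"
    by (rule subsolution_le_solution[OF T assms(16)])
  have hi: "T w \<preceq> b" for w
    using solution_le_supersolution[OF T] assms(18) Ab by simp
  have S_iff: "y \<in> S \<longleftrightarrow> T (\<iota> y) = y \<and> v\<^sub>0 \<preceq> y \<and> y \<preceq> b" for y
    by (simp add: S_def qvi_iff b_def)
  note bounds = lo[unfolded V_le_def] hi[of "\<iota> b", unfolded V_le_def]
    V_le_trans[OF lo hi, unfolded V_le_def]
  obtain m where m: "\<iota> (T m) = m" "cone_le C (\<iota> v\<^sub>0) m" "cone_le C m (\<iota> b)"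
    and least: "\<And>x. \<iota> (T x) = x \<Longrightarrow> cone_le C (\<iota> v\<^sub>0) x \<Longrightarrow> cone_le C x (\<iota> b) \<Longrightarrow> cone_le C m x"
    using ex_least_fixpoint[OF mono bounds] by blast
  obtain M where M: "\<iota> (T M) = M" "cone_le C (\<iota> v\<^sub>0) M" "cone_le C M (\<iota> b)"
    and greatest: "\<And>x. \<iota> (T x) = x \<Longrightarrow> cone_le C (\<iota> v\<^sub>0) x \<Longrightarrow> cone_le C x (\<iota> b) \<Longrightarrow> cone_le C x M"
    using ex_greatest_fixpoint[OF mono bounds] by blast
  \<comment> \<open>\<open>m\<close> and \<open>M\<close> are points of H; being fixed points, they
    are the images under \<iota> of \<open>T m\<close> and \<open>T M\<close>, which lie in
    V.\<close>
  have "T m \<in> S" "T M \<in> S"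
    using m M by (simp_all add: S_iff V_le_def)
  moreover have "T m \<preceq> y" "y \<preceq> T M" if "y \<in> S" for y
    using that least[of "\<iota> y"] greatest[of "\<iota> y"] m(1) M(1) by (simp_all add: S_iff V_le_def)
  ultimately show ?thesis by blast
qed

end
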